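(* Let $1\leq p\leq n$ and let $g_{n,p}$ be the number of maximal hypercubes of dimension $p$ in the Lucas cube $\Lambda_n$. Then \[g_{n,p}=\frac{n}{p}\binom{p}{n-2p}.\]
   Context: $Q_n$ is the $n$-dimensional hypercube: vertices are binary strings of length $n$, adjacent iff they differ in exactly one coordinate. A Lucas string of length $n$ is a binary string $b_1\dots b_n$ with $b_ib_{i+1}=0$ for $1\le i<n$ and $b_1b_n\neq1$. The Lucas cube $\Lambda_n$ ($n\ge1$) is the subgraph of $Q_n$ induced by the Lucas strings of length $n$. A hypercube of dimension $p$ in $\Lambda_n$ is an induced subgraph isomorphic to $Q_p$; it is maximal if it is not contained in any induced subgraph of $\Lambda_n$ isomorphic to $Q_{p+1}$. Binomial coefficients $\binom{a}{b}$ are $0$ when $b<0$ or $b>a$. *)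

theory Defs
  imports Complex_Main "Graph_Theory.Graph_Theory"
begin

text \<open>
  As in the library, an undirected simple graph is a symmetric loop-free digraph:
  the edge \<open>{u, v}\<close> is the pair of arcs \<open>(u, v)\<close> and \<open>(v, u)\<close>.
  A binary string \<open>b\<^sub>1 \<dots> b\<^sub>n\<close> is a list of Booleans, and \<open>b\<^sub>i\<close> is \<open>b ! (i - 1)\<close>.
\<close>

definition hypercube :: "nat \<Rightarrow> (bool list, bool list \<times> bool list) pre_digraph" where
  "hypercube n = with_proj
     \<lparr> pverts = {u. length u = n},
       parcs = {(u, v). length u = n \<and> length v = n \<and> (\<exists>!i. i < n \<and> u ! i \<noteq> v ! i)} \<rparr>"

definition lucas_string :: "nat \<Rightarrow> bool list \<Rightarrow> bool" where
  "lucas_string n b \<longleftrightarrow> length b = n \<and>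
     (\<forall>i. i + 1 < n \<longrightarrow> \<not> (b ! i \<and> b ! (i + 1))) \<and> \<not> (b ! 0 \<and> b ! (n - 1))"

text \<open>
  The cube is meant for \<open>n \<ge> 1\<close>. For \<open>n = 1\<close> the first and the last bit coincide,
  so that the string \<open>1\<close> is excluded.
\<close>

definition lucas_cube :: "nat \<Rightarrow> (bool list, bool list \<times> bool list) pre_digraph" where
  "lucas_cube n = hypercube n \<restriction> {b. lucas_string n b}"

definition cube_in_lucas_cube ::
    "nat \<Rightarrow> nat \<Rightarrow> (bool list, bool list \<times> bool list) pre_digraph \<Rightarrow> bool" where
  "cube_in_lucas_cube n p H \<longleftrightarrow>
     induced_subgraph H (lucas_cube n) \<and> digraph_iso H (hypercube p)"

definition maximal_cube_in_lucas_cube ::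
    "nat \<Rightarrow> nat \<Rightarrow> (bool list, bool list \<times> bool list) pre_digraph \<Rightarrow> bool" where
  "maximal_cube_in_lucas_cube n p H \<longleftrightarrow>
     cube_in_lucas_cube n p H \<and>
     \<not> (\<exists>K. cube_in_lucas_cube n (p + 1) K \<and> subgraph H K)"

text \<open>
  Subgraphs of a digraph inherit its tail and head functions, so distinct subgraphs
  differ in their vertices or arcs, and the cardinality below counts each cube once.
\<close>

definition num_maximal_cubes :: "nat \<Rightarrow> nat \<Rightarrow> nat" where
  "num_maximal_cubes n p = card {H. maximal_cube_in_lucas_cube n p H}"

text \<open>Truncated subtraction on \<^typ>\<open>nat\<close> would give \<open>p choose 0 = 1\<close> when \<open>n < 2 * p\<close>.\<close>

definition binom :: "nat \<Rightarrow> int \<Rightarrow> nat" where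
  "binom a b = (if b < 0 then 0 else a choose nat b)"

lemma graph_hypercube: "graph (hypercube n)"
proof -
  define D where "D = (\<lambda>u v :: bool list. \<exists>!i. i < n \<and> u ! i \<noteq> v ! i)"
  have Q: "hypercube n = with_proj
    \<lparr> pverts = {u. length u = n}, parcs = {(u, v). length u = n \<and> length v = n \<and> D u v} \<rparr>"
    unfolding hypercube_def D_def ..
  have irrefl: "\<not> D u u" for u
    unfolding D_def by (rule notI, erule ex1E) simp
  have flip: "D v u" if "D u v" for u v
  proof -
    from that obtain i where i: "i < n" "u ! i \<noteq> v ! i"
      and uniq: "\<And>j. j < n \<and> u ! j \<noteq> v ! j \<Longrightarrow> j = i"
      unfolding D_def by (elim ex1E) blast
    show ?thesis
      unfolding D_def
    proof (rule ex1I[of _ i])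
      show "i < n \<and> v ! i \<noteq> u ! i"
        using i by simp
      show "j = i" if "j < n \<and> v ! j \<noteq> u ! j" for j
        using that by (intro uniq) simp
    qed
  qed
  let ?V = "{u :: bool list. length u = n}"
  have fin: "finite ?V"
    using finite_lists_length_eq[of "UNIV :: bool set" n] by simp
  have finA: "finite (arcs (hypercube n))"
  proof (rule finite_subset)
    show "arcs (hypercube n) \<subseteq> ?V \<times> ?V"
      unfolding Q by auto
    show "finite (?V \<times> ?V)"
      using fin fin by (rule finite_cartesian_product)
  qed
  have finV: "finite (verts (hypercube n))"
    unfolding Q using fin by simp
  have symm: "symmetric (hypercube n)"
    unfolding symmetric_def Q by (rule symI) (simp add: flip)
  have wf: "wf_digraph (hypercube n)"
    unfolding Q by (rule wf_digraph.intro) auto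
  have loopfree: "loopfree_digraph (hypercube n)"
  proof (rule loopfree_digraph.intro[OF wf], rule loopfree_digraph_axioms.intro)
    fix e assume "e \<in> arcs (hypercube n)"
    then have "D (fst e) (snd e)"
      by (cases e) (simp add: Q)
    then have "fst e \<noteq> snd e"
      using irrefl[of "fst e"] by metis
    then show "tail (hypercube n) e \<noteq> head (hypercube n) e"
      by (simp add: Q)
  qed
  have nomulti: "nomulti_digraph (hypercube n)"
    by (rule nomulti_digraph.intro[OF wf], rule nomulti_digraph_axioms.intro)
      (simp add: Q arc_to_ends_def)
  have "fin_digraph (hypercube n)"
    by (rule fin_digraph.intro[OF wf], rule fin_digraph_axioms.intro) (fact finV, fact finA)
  then have "digraph (hypercube n)"
    using loopfree nomulti by (rule digraph.intro)
  then show ?thesis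
    using symm by (rule digraph.graphI)
qed

lemma graph_lucas_cube: "graph (lucas_cube n)"
proof -
  interpret graph "hypercube n" by (rule graph_hypercube)
  have "{b. lucas_string n b} \<subseteq> verts (hypercube n)"
    by (auto simp: lucas_string_def hypercube_def)
  then have ind: "induced_subgraph (lucas_cube n) (hypercube n)"
    unfolding lucas_cube_def by (rule induced_induce)
  interpret L: digraph "lucas_cube n" using ind by (rule digraphI_induced)
  show ?thesis
    using induced_graph_imp_symmetric[OF sym_arcs ind] by (rule L.graphI)
qed

end

(*
  A subgraph of a hypercube isomorphic to Q_p is an interval between a set B and a set T of
  positions with p elements between them. Lucas strings are closed under turning ones into zeros,
  so an interval whose top is a Lucas string lies in the Lucas cube, and it is maximal exactly if
  its bottom is 0 and no further one can be added to its top. In such a top the cyclic gaps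
  between consecutive ones have length 2 or 3. If the first bit is 1, the string is therefore a
  concatenation of p blocks 10 or 100, with n - 2p blocks 100; counting pairs of a string and
  one of its ones, up to rotation, gives the factor n / p.
*)
theory Submission
  imports Defs
begin

section \<open>Binary strings as sets of positions\<close>

definition ones :: "bool list \<Rightarrow> nat set" where
  "ones u = {i. i < length u \<and> u ! i}"

definition string_of :: "nat \<Rightarrow> nat set \<Rightarrow> bool list" where
  "string_of n S = map (\<lambda>i. i \<in> S) [0..<n]"

lemma length_string_of [simp]: "length (string_of n S) = n"
  by (simp add: string_of_def)

lemma ones_string_of: "S \<subseteq> {..<n} \<Longrightarrow> ones (string_of n S) = S"
  by (auto simp: ones_def string_of_def)

lemma ones_subset: "length u = n \<Longrightarrow> ones u \<subseteq> {..<n}"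
  by (auto simp: ones_def)

lemma ones_eqD: "ones u = ones v \<Longrightarrow> length u = length v \<Longrightarrow> u = v"
  by (rule nth_equalityI) (auto simp: ones_def)

lemma string_of_ones: "length u = n \<Longrightarrow> string_of n (ones u) = u"
  by (rule nth_equalityI) (auto simp: ones_def string_of_def)

lemma card_ones: "card (ones u) = length (filter id u)"
  by (simp add: ones_def length_filter_conv_card)

text \<open>This will count block codes: which of the blocks are the long ones.\<close>

lemma card_strings_weight:
  "card {u. length u = n \<and> length (filter id u) = k} = n choose k"
proof -
  have "bij_betw ones {u. length u = n \<and> length (filter id u) = k} {S. S \<subseteq> {..<n} \<and> card S = k}"
    by (rule bij_betw_byWitness[where f' = "string_of n"])
       (auto simp: string_of_ones ones_string_of card_ones[symmetric]
         dest: subsetD[OF ones_subset[OF refl]])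
  then have "card {u. length u = n \<and> length (filter id u) = k} = card {S. S \<subseteq> {..<n} \<and> card S = k}"
    by (rule bij_betw_same_card)
  also have "\<dots> = n choose k"
    by (simp add: n_subsets)
  finally show ?thesis .
qed

section \<open>Induced subcubes of a hypercube\<close>

definition interval :: "nat \<Rightarrow> nat set \<Rightarrow> nat set \<Rightarrow> bool list set" where
  "interval n B T = {u. length u = n \<and> B \<subseteq> ones u \<and> ones u \<subseteq> T}"

lemma verts_hypercube: "verts (hypercube n) = {u. length u = n}"
  and tail_hypercube [simp]: "tail (hypercube n) = fst"
  and head_hypercube [simp]: "head (hypercube n) = snd"
  by (auto simp: hypercube_def)

text \<open>Adjacency as the flip of one position \<open>d\<close>. That \<open>d\<close> is below
  \<open>n\<close> is implicit: it lies in exactly one of two sets of positions below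
  \<open>n\<close>.\<close>

lemma arcs_hypercube:
  "(u, v) \<in> arcs (hypercube n) \<longleftrightarrow>
    length u = n \<and> length v = n \<and> (\<exists>d. ones v = sym_diff (ones u) {d})"
proof -
  have "(\<exists>!i. i < n \<and> u ! i \<noteq> v ! i) \<longleftrightarrow> (\<exists>d. ones v = sym_diff (ones u) {d})"
    if "length u = n" "length v = n"
  proof
    assume "\<exists>!i. i < n \<and> u ! i \<noteq> v ! i"
    then obtain d where d: "\<And>i. i < n \<and> u ! i \<noteq> v ! i \<longleftrightarrow> i = d"
      by metis
    have "i \<in> ones v \<longleftrightarrow> i \<in> sym_diff (ones u) {d}" for i
      using d[of i] that by (auto simp: ones_def)
    then show "\<exists>d. ones v = sym_diff (ones u) {d}"
      by blast
  next
    assume "\<exists>d. ones v = sym_diff (ones u) {d}"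
    then obtain d where "ones v = sym_diff (ones u) {d}" ..
    then have d: "i \<in> ones v \<longleftrightarrow> (i \<in> ones u \<longleftrightarrow> i \<noteq> d)" for i
      by auto
    have "i < n \<and> u ! i \<noteq> v ! i \<longleftrightarrow> i = d" for i
      using d[of i] that by (auto simp: ones_def)
    then show "\<exists>!i. i < n \<and> u ! i \<noteq> v ! i"
      by simp
  qed
  then show ?thesis
    by (auto simp: hypercube_def)
qed

text \<open>
  Any square \<open>W, W + i, W + j, W + i + j\<close> is mapped to a square of the ambient cube, in which
  opposite sides have the same direction; so the directions of the sides at \<open>{}\<close> determine \<open>f\<close>.
\<close>

lemma cube_embedding_directions:
  fixes f :: "'a set \<Rightarrow> 'b set"
  assumes fin: "finite I" and inj: "inj_on f (Pow I)"
    and adj: "\<And>X i. X \<subseteq> I \<Longrightarrow> i \<in> I - X \<Longrightarrow> \<exists>d. f (insert i X) = sym_diff (f X) {d}"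
  obtains d where "inj_on d I" "\<And>X. X \<subseteq> I \<Longrightarrow> f X = sym_diff (f {}) (d ` X)"
proof -
  have "\<forall>i\<in>I. \<exists>d. f {i} = sym_diff (f {}) {d}"
    using adj[of "{}"] by auto
  then obtain d where d: "\<And>i. i \<in> I \<Longrightarrow> f {i} = sym_diff (f {}) {d i}"
    by metis
  have inj_d: "inj_on d I"
  proof (rule inj_onI)
    fix i j assume "i \<in> I" "j \<in> I" "d i = d j"
    then have "f {i} = f {j}" by (simp add: d)
    then show "i = j" using inj \<open>i \<in> I\<close> \<open>j \<in> I\<close> by (auto dest: inj_onD)
  qed
  have "f X = sym_diff (f {}) (d ` X)" if "X \<subseteq> I" for X
    using that
  proof (induction "card X" arbitrary: X rule: less_induct)
    case less
    have finX: "finite X" using less.prems fin by (rule finite_subset)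
    consider "X = {}" | i where "X = {i}" | i j where "i \<in> X" "j \<in> X" "i \<noteq> j"
      by blast
    then show ?case
    proof cases
      case 3
      \<comment> \<open>\<open>W\<close>, \<open>W + i\<close>, \<open>W + j\<close> and
        \<open>X\<close> form a square; the induction hypothesis covers its three smaller
        corners.\<close>
      define W where "W = X - {i, j}"
      have X: "X = insert i (insert j W)" "i \<notin> W" "j \<notin> W" "W \<subseteq> I" "i \<in> I" "j \<in> I"
        using 3 less.prems by (auto simp: W_def)
      have dn: "d i \<notin> d ` W" "d j \<notin> d ` W" "d i \<noteq> d j"
        using inj_d X 3 by (auto simp: inj_on_def)
      have IH: "f Y = sym_diff (f {}) (d ` Y)" if "Y \<subset> X" for Y
        using less.hyps[OF psubset_card_mono[OF finX that]] that less.prems by blast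
      have fW: "f W = sym_diff (f {}) (d ` W)"
        using X 3 by (intro IH) auto
      have fi: "f (insert i W) = sym_diff (f {}) (d ` insert i W)"
        using X 3 by (intro IH) auto
      have fj: "f (insert j W) = sym_diff (f {}) (d ` insert j W)"
        using X 3 by (intro IH) auto
      obtain a where a: "f X = sym_diff (f (insert j W)) {a}"
        using adj[of "insert j W" i] X 3 by auto
      obtain b where b: "f X = sym_diff (f (insert i W)) {b}"
        using adj[of "insert i W" j] X 3 by (auto simp: insert_commute)
      have "f X \<noteq> f W"
      proof
        assume "f X = f W"
        moreover have "X \<in> Pow I" "W \<in> Pow I" using X less.prems by auto
        ultimately have "X = W" using inj by (blast dest: inj_onD)
        then show False using X by blast
      qed
      have memW: "z \<in> f W \<longleftrightarrow> (z \<in> f {}) \<noteq> (z \<in> d ` W)" for z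
        unfolding fW by blast
      have mem_a: "z \<in> f X \<longleftrightarrow> ((z \<in> f W) \<noteq> (z = d j)) \<noteq> (z = a)" for z
        unfolding a fj fW using dn by (cases "z = d j") auto
      have mem_b: "z \<in> f X \<longleftrightarrow> ((z \<in> f W) \<noteq> (z = d i)) \<noteq> (z = b)" for z
        unfolding b fi fW using dn by (cases "z = d i") auto
      \<comment> \<open>The flip \<open>a = d j\<close> would lead back to \<open>f W\<close>,
        against injectivity.\<close>
      have "a \<noteq> d j"
        using mem_a \<open>f X \<noteq> f W\<close> by blast
      \<comment> \<open>Both routes from \<open>f W\<close> to \<open>f X\<close> flip the same
        positions, so \<open>{d j, a} = {d i, b}\<close>; since \<open>d i \<noteq> d j\<close>,
        this forces \<open>b = d j\<close> and \<open>a = d i\<close>.\<close>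
      then have "a = d i"
        using mem_a[of "d j"] mem_b[of "d j"] mem_a[of a] mem_b[of a] dn(3) by metis
      have "z \<in> d ` X \<longleftrightarrow> z = d i \<or> z = d j \<or> z \<in> d ` W" for z
        unfolding X(1) by blast
      then have "z \<in> f X \<longleftrightarrow> (z \<in> f {}) \<noteq> (z \<in> d ` X)" for z
        unfolding mem_a memW \<open>a = d i\<close> using dn by metis
      then show ?thesis
        by blast
    qed (use d less.prems in auto)
  qed
  with inj_d show ?thesis by (rule that)
qed

section \<open>Digraph isomorphisms as bijections between vertex sets\<close>

lemma digraph_iso_with_projD:
  assumes "digraph_iso H Q" and "tail H = fst" "head H = snd" "tail Q = fst" "head Q = snd"
  obtains g where "bij_betw g (verts Q) (verts H)"
    "\<And>u v. (u, v) \<in> arcs Q \<Longrightarrow> (g u, g v) \<in> arcs H"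
proof -
  from assms(1) obtain f where f: "pre_digraph.digraph_isomorphism H f" and Q: "Q = app_iso f H"
    unfolding digraph_iso_def by blast
  \<comment> \<open>The inverse vertex map, because cubes are to be parametrised by the vertices of
    the model \<open>Q\<close>.\<close>
  define g where "g = the_inv_into (verts H) (iso_verts f)"
  have wf: "wf_digraph H" and inj: "inj_on (iso_verts f) (verts H)"
    using f by (auto simp: pre_digraph.digraph_isomorphism_def)
  have "bij_betw g (verts Q) (verts H)"
    using inj unfolding g_def Q by (simp add: bij_betw_the_inv_into bij_betw_def inj_on_the_inv_into)
  moreover have "(g u, g v) \<in> arcs H" if uv: "(u, v) \<in> arcs Q" for u v
  proof -
    obtain x y where xy: "(x, y) \<in> arcs H" "(u, v) = iso_arcs f (x, y)"
      using uv unfolding Q by auto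
    have "x \<in> verts H" "y \<in> verts H"
      using wf_digraph.tail_in_verts[OF wf xy(1)] wf_digraph.head_in_verts[OF wf xy(1)]
      by (simp_all add: assms)
    moreover have "iso_verts f x = u" "iso_verts f y = v"
      using pre_digraph.iso_verts_tail[OF f xy(1)] pre_digraph.iso_verts_head[OF f xy(1)]
        assms xy(2)[symmetric] by (simp_all add: Q)
    ultimately show ?thesis
      using xy(1) inj by (auto simp: g_def the_inv_into_f_f)
  qed
  ultimately show ?thesis by (rule that)
qed

text \<open>Since an arc is the pair of its ends, the arc map is forced to be
  \<open>map_prod h h\<close>; a bijection that preserves and reflects adjacency therefore
  suffices.\<close>

lemma digraph_iso_with_projI:
  assumes "wf_digraph H" "wf_digraph Q"
    and "tail H = fst" "head H = snd" "tail Q = fst" "head Q = snd"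
    and bij: "bij_betw h (verts H) (verts Q)"
    and arcs: "\<And>u v. u \<in> verts H \<Longrightarrow> v \<in> verts H \<Longrightarrow> (u, v) \<in> arcs H \<longleftrightarrow> (h u, h v) \<in> arcs Q"
  shows "digraph_iso H Q"
proof -
  interpret H: wf_digraph H by fact
  interpret Q: wf_digraph Q by fact
  define f where "f = \<lparr>iso_verts = h, iso_arcs = map_prod h h, iso_head = snd, iso_tail = fst\<rparr>"
  have vH: "u \<in> verts H" "v \<in> verts H" if "(u, v) \<in> arcs H" for u v
    using H.tail_in_verts[OF that] H.head_in_verts[OF that] assms by auto
  have vQ: "u \<in> verts Q" "v \<in> verts Q" if "(u, v) \<in> arcs Q" for u v
    using Q.tail_in_verts[OF that] Q.head_in_verts[OF that] assms by auto
  have inj: "inj_on h (verts H)" and img: "h ` verts H = verts Q"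
    using bij by (auto simp: bij_betw_def)
  have "inj_on (map_prod h h) (arcs H)"
    using inj vH by (auto simp: inj_on_def)
  then have "H.digraph_isomorphism f"
    using inj assms unfolding H.digraph_isomorphism_def f_def by (auto simp: H.wf_digraph_axioms)
  moreover have "arcs Q = map_prod h h ` arcs H"
  proof (intro set_eqI iffI)
    fix e assume e: "e \<in> arcs Q"
    obtain u v where uv: "e = (u, v)" by (cases e)
    with e vQ[of u v] img obtain x y where "x \<in> verts H" "y \<in> verts H" "u = h x" "v = h y"
      by (metis imageE)
    then show "e \<in> map_prod h h ` arcs H"
      using e uv arcs by (auto intro!: image_eqI[of _ _ "(x, y)"])
  next
    fix e assume "e \<in> map_prod h h ` arcs H"
    then obtain x y where xy: "(x, y) \<in> arcs H" "e = (h x, h y)"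
      by auto
    then show "e \<in> arcs Q"
      using arcs[OF vH[OF xy(1)]] by simp
  qed
  then have "Q = app_iso f H"
    using assms img by (auto intro!: pre_digraph.equality simp: f_def)
  ultimately show ?thesis
    unfolding digraph_iso_def by blast
qed


section \<open>Cubes in the Lucas cube\<close>

text \<open>The successor is taken cyclically. For \<open>n = 1\<close> position 0 follows itself,
  so \<open>{0}\<close> is excluded, as in \<open>lucas_string\<close>.\<close>

definition lucas_set :: "nat \<Rightarrow> nat set \<Rightarrow> bool" where
  "lucas_set n T \<longleftrightarrow> T \<subseteq> {..<n} \<and> (\<forall>i<n. \<not> (i \<in> T \<and> Suc i mod n \<in> T))"

text \<open>Testing single positions captures inclusion-maximality, because Lucas sets are closed
  under subsets.\<close>

definition maximal_lucas_set :: "nat \<Rightarrow> nat set \<Rightarrow> bool" where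
  "maximal_lucas_set n T \<longleftrightarrow>
    lucas_set n T \<and> (\<forall>i<n. i \<notin> T \<longrightarrow> \<not> lucas_set n (insert i T))"

lemma lucas_set_subset: "lucas_set n T \<Longrightarrow> T \<subseteq> {..<n}"
  by (simp add: lucas_set_def)

lemma lucas_set_finite: "lucas_set n T \<Longrightarrow> finite T"
  using finite_subset[OF lucas_set_subset] by blast

lemma lucas_set_mono: "lucas_set n T \<Longrightarrow> S \<subseteq> T \<Longrightarrow> lucas_set n S"
  unfolding lucas_set_def by blast

lemma lucas_string_iff:
  assumes "0 < n"
  shows "lucas_string n b \<longleftrightarrow> length b = n \<and> lucas_set n (ones b)"
proof (cases "length b = n")
  case True
  have "lucas_set n (ones b) \<longleftrightarrow> (\<forall>i<n. \<not> (b ! i \<and> b ! (Suc i mod n)))"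
    using True assms by (auto simp: lucas_set_def ones_def)
  also have "\<dots> \<longleftrightarrow> (\<forall>i. i + 1 < n \<longrightarrow> \<not> (b ! i \<and> b ! (i + 1))) \<and> \<not> (b ! 0 \<and> b ! (n - 1))"
  proof (intro iffI conjI allI impI)
    fix i assume *: "(\<forall>i. i + 1 < n \<longrightarrow> \<not> (b ! i \<and> b ! (i + 1))) \<and> \<not> (b ! 0 \<and> b ! (n - 1))" "i < n"
    then show "\<not> (b ! i \<and> b ! (Suc i mod n))"
      by (cases "Suc i = n") auto
  next
    assume *: "\<forall>i<n. \<not> (b ! i \<and> b ! (Suc i mod n))"
    show "\<not> (b ! 0 \<and> b ! (n - 1))"
      \<comment> \<open>The successor of \<open>n - 1\<close> modulo \<open>n\<close> is 0: this
        instance is the wrap-around pair.\<close>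
      using *[rule_format, of "n - 1"] assms by auto
    fix i assume "i + 1 < n"
    then show "\<not> (b ! i \<and> b ! (i + 1))"
      using *[rule_format, of i] by simp
  qed
  finally show ?thesis
    using True by (simp add: lucas_string_def)
qed (simp add: lucas_string_def)

lemma verts_lucas_cube: "verts (lucas_cube n) = {b. lucas_string n b}"
  and tail_lucas_cube [simp]: "tail (lucas_cube n) = fst"
  and head_lucas_cube [simp]: "head (lucas_cube n) = snd"
  by (simp_all add: lucas_cube_def)

lemma arcs_lucas_cube: "arcs (lucas_cube n) \<subseteq> arcs (hypercube n)"
  by (auto simp: lucas_cube_def)

lemma wf_lucas_cube: "wf_digraph (lucas_cube n)"
proof -
  interpret graph "lucas_cube n" by (rule graph_lucas_cube)
  show ?thesis ..
qed

lemma wf_hypercube: "wf_digraph (hypercube n)"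
proof -
  interpret graph "hypercube n" by (rule graph_hypercube)
  show ?thesis ..
qed

text \<open>An induced subgraph is determined by its vertices, so cubes can be handled through their
  vertex sets.\<close>

lemma induced_subgraph_eq: "induced_subgraph H G \<Longrightarrow> H = G \<restriction> verts H"
  by (rule pre_digraph.equality)
     (auto simp: induced_subgraph_def subgraph_def compatible_def)

lemma interval_subset_verts_lucas_cube:
  assumes "0 < n" "lucas_set n T"
  shows "interval n B T \<subseteq> verts (lucas_cube n)"
  using assms lucas_set_mono[OF assms(2)]
  by (auto simp: interval_def verts_lucas_cube lucas_string_iff)

text \<open>The strings of \<open>B\<close> and \<open>T\<close> are themselves members of the
  interval, so containment can be tested on these two.\<close>

lemma interval_subset_iff:
  assumes "B \<subseteq> T" "T \<subseteq> {..<n}"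
  shows "interval n B T \<subseteq> interval n B' T' \<longleftrightarrow> B' \<subseteq> B \<and> T \<subseteq> T'"
proof
  assume *: "interval n B T \<subseteq> interval n B' T'"
  have "B \<subseteq> {..<n}" using assms by blast
  then have "string_of n B \<in> interval n B T" "string_of n T \<in> interval n B T"
    using assms by (auto simp: interval_def ones_string_of)
  with * have "string_of n B \<in> interval n B' T'" "string_of n T \<in> interval n B' T'"
    by auto
  then show "B' \<subseteq> B \<and> T \<subseteq> T'"
    using assms \<open>B \<subseteq> {..<n}\<close> by (auto simp: interval_def ones_string_of)
qed (auto simp: interval_def)

text \<open>Read on sets of positions, the isomorphism embeds the power set of \<open>{..<p}\<close>
  so that adding an element flips one position. Its image is \<open>f {}\<close> with arbitrary
  subsets of \<open>p\<close> fixed positions flipped, which is an interval.\<close>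

lemma cube_in_lucas_cube_imp_interval:
  assumes "0 < n" and cube: "cube_in_lucas_cube n p H"
  obtains B T where "B \<subseteq> T" "card (T - B) = p" "lucas_set n T" "H = lucas_cube n \<restriction> interval n B T"
proof -
  have ind: "induced_subgraph H (lucas_cube n)" and iso: "digraph_iso H (hypercube p)"
    using cube by (auto simp: cube_in_lucas_cube_def)
  have H: "H = lucas_cube n \<restriction> verts H"
    using ind by (rule induced_subgraph_eq)
  have vH: "verts H \<subseteq> verts (lucas_cube n)" and aH: "arcs H \<subseteq> arcs (hypercube n)"
    and tH: "tail H = fst" "head H = snd"
    using ind arcs_lucas_cube[of n] by (auto simp: induced_subgraph_def subgraph_def compatible_def)
  obtain g where g: "bij_betw g (verts (hypercube p)) (verts H)"
    and g_arcs: "\<And>u v. (u, v) \<in> arcs (hypercube p) \<Longrightarrow> (g u, g v) \<in> arcs H"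
    using digraph_iso_with_projD[OF iso tH] by auto
  have len: "length u = n" if "u \<in> verts H" for u
    using that vH by (auto simp: verts_lucas_cube lucas_string_def)
  have gH: "g x \<in> verts H" if "length x = p" for x
    using g that by (auto simp: bij_betw_def verts_hypercube)
  define f where "f X = ones (g (string_of p X))" for X
  have "inj_on f (Pow {..<p})"
  proof (rule inj_onI)
    fix X Y assume XY: "X \<in> Pow {..<p}" "Y \<in> Pow {..<p}" "f X = f Y"
    then have "g (string_of p X) = g (string_of p Y)"
      by (intro ones_eqD) (auto simp: f_def len gH)
    then have "string_of p X = string_of p Y"
      using g by (auto simp: bij_betw_def verts_hypercube dest: inj_onD)
    then have "ones (string_of p X) = ones (string_of p Y)" by simp
    then show "X = Y"
      using XY by (simp add: ones_string_of)
  qed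
  moreover have "\<exists>d. f (insert i X) = sym_diff (f X) {d}" if "X \<subseteq> {..<p}" "i \<in> {..<p} - X" for X i
  proof -
    have "(string_of p X, string_of p (insert i X)) \<in> arcs (hypercube p)"
      using that by (auto simp: arcs_hypercube ones_string_of intro!: exI[of _ i])
    then have "(g (string_of p X), g (string_of p (insert i X))) \<in> arcs (hypercube n)"
      using g_arcs aH by blast
    then show ?thesis
      by (simp add: arcs_hypercube f_def)
  qed
  ultimately obtain d where inj_d: "inj_on d {..<p}"
    and d: "\<And>X. X \<subseteq> {..<p} \<Longrightarrow> f X = sym_diff (f {}) (d ` X)"
    using cube_embedding_directions[of "{..<p}" f] by (metis finite_lessThan)
  \<comment> \<open>\<open>A\<close> comes from the zero string of \<open>Q_p\<close> and can be any
    corner of the cube; \<open>D\<close> is the set of its directions. Bottom and top are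
    \<open>A - D\<close> and \<open>A \<union> D\<close>.\<close>
  define A D where "A = f {}" and "D = d ` {..<p}"
  have "verts H = interval n (A - D) (A \<union> D)"
  proof (intro set_eqI iffI)
    fix u assume u: "u \<in> verts H"
    then obtain x where x: "length x = p" "u = g x"
      using g by (auto simp: bij_betw_def verts_hypercube)
    then have "ones u = sym_diff A (d ` ones x)"
      using d[OF ones_subset[of x p]] by (simp add: f_def A_def string_of_ones)
    moreover have "d ` ones x \<subseteq> D"
      using ones_subset[of x p] x by (auto simp: D_def)
    ultimately show "u \<in> interval n (A - D) (A \<union> D)"
      using len[OF u] by (auto simp: interval_def)
  next
    fix u assume u: "u \<in> interval n (A - D) (A \<union> D)"
    then have "sym_diff A (ones u) \<subseteq> d ` {..<p}"
      by (auto simp: interval_def D_def)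
    then obtain X where X: "X \<subseteq> {..<p}" "sym_diff A (ones u) = d ` X"
      by (auto simp: subset_image_iff)
    have "f X = ones u"
      using d[OF X(1)] X(2) unfolding A_def[symmetric] by blast
    then have "g (string_of p X) = u"
      using u by (intro ones_eqD) (auto simp: f_def len gH interval_def)
    then show "u \<in> verts H"
      using gH[of "string_of p X"] by simp
  qed
  \<comment> \<open>The top is reached from \<open>A\<close> by flipping \<open>D - A\<close>, hence
    is a vertex of \<open>H\<close> and so a Lucas string.\<close>
  moreover have "lucas_set n (A \<union> D)"
  proof -
    have "f (d -` (D - A) \<inter> {..<p}) = sym_diff A (d ` (d -` (D - A) \<inter> {..<p}))"
      using d[of "d -` (D - A) \<inter> {..<p}"] by (simp add: A_def)
    also have "d ` (d -` (D - A) \<inter> {..<p}) = D - A"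
      by (auto simp: D_def)
    finally have "ones (g (string_of p (d -` (D - A) \<inter> {..<p}))) = A \<union> D"
      by (auto simp: f_def)
    moreover have "g (string_of p (d -` (D - A) \<inter> {..<p})) \<in> verts (lucas_cube n)"
      using gH vH by auto
    ultimately show ?thesis
      using \<open>0 < n\<close> by (auto simp: verts_lucas_cube lucas_string_iff)
  qed
  moreover have "(A \<union> D) - (A - D) = D"
    by blast
  moreover have "card D = p"
    using inj_d by (simp add: D_def card_image)
  ultimately show ?thesis
    using H by (intro that[of "A - D" "A \<union> D"]) auto
qed

lemma interval_cube_in_lucas_cube:
  assumes "0 < n" "B \<subseteq> T" "card (T - B) = p" and T: "lucas_set n T"
  shows "cube_in_lucas_cube n p (lucas_cube n \<restriction> interval n B T)"
proof -
  let ?H = "lucas_cube n \<restriction> interval n B T"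
  note Tn = lucas_set_subset[OF T]
  have sub: "interval n B T \<subseteq> verts (lucas_cube n)"
    using assms by (intro interval_subset_verts_lucas_cube)
  then have ind: "induced_subgraph ?H (lucas_cube n)"
    using wf_lucas_cube wf_digraph.induced_induce by blast
  have "finite (T - B)"
    using lucas_set_finite[OF T] by simp
  then obtain e where e: "bij_betw e {..<p} (T - B)"
    using ex_bij_betw_nat_finite[of "T - B"] assms by (auto simp: atLeast0LessThan)
  then have e_mem: "e j \<in> T" "e j \<notin> B" if "j < p" for j
    using that by (auto simp: bij_betw_def)
  have e_inj: "e i = e j \<longleftrightarrow> i = j" if "i < p" "j < p" for i j
    using e that by (auto simp: bij_betw_def inj_on_def)
  have e_ex: "\<exists>j<p. e j = t" if "t \<in> T" "t \<notin> B" for t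
  proof -
    have "t \<in> e ` {..<p}" using e that by (auto simp: bij_betw_def)
    then show ?thesis by auto
  qed
  \<comment> \<open>\<open>h\<close> reads off the free positions \<open>T - B\<close> in the order
    given by \<open>e\<close>; its inverse puts ones on \<open>B\<close> and on the selected free
    positions.\<close>
  define h where "h u = string_of p {j. j < p \<and> e j \<in> ones u}" for u
  have ones_h: "ones (h u) = {j. j < p \<and> e j \<in> ones u}" for u
    unfolding h_def by (rule ones_string_of) auto
  have len_h: "length (h u) = p" for u
    by (simp add: h_def)
  have "digraph_iso ?H (hypercube p)"
  proof (rule digraph_iso_with_projI)
    show "bij_betw h (verts ?H) (verts (hypercube p))"
    proof (rule bij_betw_byWitness[where f' = "\<lambda>x. string_of n (B \<union> e ` ones x)"])
      have sub_n: "B \<union> e ` ones x \<subseteq> {..<n}" "B \<union> e ` ones x \<subseteq> T" if "length x = p" for x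
        using ones_subset[OF that] e_mem Tn \<open>B \<subseteq> T\<close> by auto
      show "\<forall>u\<in>verts ?H. string_of n (B \<union> e ` ones (h u)) = u"
      proof
        fix u assume u: "u \<in> verts ?H"
        then have "B \<union> e ` ones (h u) = ones u"
          using e_ex by (fastforce simp: ones_h interval_def)
        then show "string_of n (B \<union> e ` ones (h u)) = u"
          using u by (simp add: string_of_ones interval_def)
      qed
      show "\<forall>x\<in>verts (hypercube p). h (string_of n (B \<union> e ` ones x)) = x"
      proof
        fix x assume "x \<in> verts (hypercube p)"
        then have x: "length x = p" by (simp add: verts_hypercube)
        have "ones (h (string_of n (B \<union> e ` ones x))) = ones x"
          using ones_subset[OF x] e_mem e_inj by (auto simp: ones_h ones_string_of[OF sub_n(1)[OF x]])
        then show "h (string_of n (B \<union> e ` ones x)) = x"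
          by (rule ones_eqD) (simp add: len_h x)
      qed
      show "h ` verts ?H \<subseteq> verts (hypercube p)"
        by (auto simp: verts_hypercube len_h)
      show "(\<lambda>x. string_of n (B \<union> e ` ones x)) ` verts (hypercube p) \<subseteq> verts ?H"
      proof (rule image_subsetI)
        fix x assume "x \<in> verts (hypercube p)"
        then have x: "length x = p" by (simp add: verts_hypercube)
        show "string_of n (B \<union> e ` ones x) \<in> verts ?H"
          using sub_n(2)[OF x] by (auto simp: interval_def ones_string_of[OF sub_n(1)[OF x]])
      qed
    qed
    fix u v assume "u \<in> verts ?H" "v \<in> verts ?H"
    then have uv: "u \<in> interval n B T" "v \<in> interval n B T"
      by auto
    then have "(u, v) \<in> arcs ?H \<longleftrightarrow> (u, v) \<in> arcs (hypercube n)"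
      using sub by (auto simp: lucas_cube_def)
    also have "\<dots> \<longleftrightarrow> (\<exists>d. ones v = sym_diff (ones u) {d})"
      using uv by (auto simp: arcs_hypercube interval_def)
    also have "\<dots> \<longleftrightarrow> (\<exists>j. ones (h v) = sym_diff (ones (h u)) {j})"
    proof
      assume "\<exists>d. ones v = sym_diff (ones u) {d}"
      then obtain t where t: "ones v = sym_diff (ones u) {t}" ..
      then have "t \<in> T" "t \<notin> B"
        using uv by (auto simp: interval_def)
      then obtain j where "j < p" "e j = t"
        using e_ex by blast
      then have "ones (h v) = sym_diff (ones (h u)) {j}"
        using t e_inj by (auto simp: ones_h)
      then show "\<exists>j. ones (h v) = sym_diff (ones (h u)) {j}" ..
    next
      assume "\<exists>j. ones (h v) = sym_diff (ones (h u)) {j}"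
      then obtain j where j: "ones (h v) = sym_diff (ones (h u)) {j}" ..
      have mem: "i \<in> ones (h v) \<longleftrightarrow> (i \<in> ones (h u)) \<noteq> (i = j)" for i
        unfolding j by blast
      have "j < p"
        using mem[of j] by (auto simp: ones_h)
      have "t \<in> ones v \<longleftrightarrow> (t \<in> ones u) \<noteq> (t = e j)" for t
      \<comment> \<open>Outside \<open>T - B\<close> all members of the interval agree, and
        \<open>e j\<close> lies inside.\<close>
      proof (cases "t \<in> T - B")
        case True
        then obtain i where "i < p" "e i = t" using e_ex by blast
        then show ?thesis
          using mem[of i] e_inj \<open>j < p\<close> by (auto simp: ones_h)
      next
        case False
        then show ?thesis
          using uv e_mem[OF \<open>j < p\<close>] by (auto simp: interval_def)
      qed
      then have "ones v = sym_diff (ones u) {e j}"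
        by blast
      then show "\<exists>d. ones v = sym_diff (ones u) {d}" ..
    qed
    also have "\<dots> \<longleftrightarrow> (h u, h v) \<in> arcs (hypercube p)"
      by (simp add: arcs_hypercube len_h)
    finally show "(u, v) \<in> arcs ?H \<longleftrightarrow> (h u, h v) \<in> arcs (hypercube p)" .
  qed (use wf_digraph.wellformed_induce_subgraph[OF wf_lucas_cube] wf_hypercube in auto)
  with ind show ?thesis
    by (simp add: cube_in_lucas_cube_def)
qed

section \<open>Maximal cubes and maximal Lucas sets\<close>

lemma subgraph_induce_iff:
  assumes "wf_digraph G"
  shows "subgraph (G \<restriction> V) (G \<restriction> W) \<longleftrightarrow> V \<subseteq> W"
  using wf_digraph.wellformed_induce_subgraph[OF assms]
  by (auto simp: subgraph_def compatible_def)

lemma maximal_cube_in_lucas_cube_iff: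
  assumes "0 < n"
  shows "maximal_cube_in_lucas_cube n p H \<longleftrightarrow>
    (\<exists>T. maximal_lucas_set n T \<and> card T = p \<and> H = lucas_cube n \<restriction> interval n {} T)"
proof
  assume H: "maximal_cube_in_lucas_cube n p H"
  then obtain B T where BT: "B \<subseteq> T" "card (T - B) = p" and T: "lucas_set n T"
    and H_eq: "H = lucas_cube n \<restriction> interval n B T"
    using cube_in_lucas_cube_imp_interval[OF assms] unfolding maximal_cube_in_lucas_cube_def by metis
  \<comment> \<open>Every larger candidate is an interval, so maximality becomes a statement about
    pairs of bottom and top.\<close>
  have no_ext: "\<not> (B' \<subseteq> B \<and> T \<subseteq> T')"
    if "B' \<subseteq> T'" "card (T' - B') = p + 1" "lucas_set n T'" for B' T'
    using H interval_cube_in_lucas_cube[OF assms that]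
    unfolding maximal_cube_in_lucas_cube_def H_eq subgraph_induce_iff[OF wf_lucas_cube]
    by (metis interval_subset_iff[OF BT(1) lucas_set_subset[OF T]] subgraph_induce_iff[OF wf_lucas_cube])
  note fin = lucas_set_finite[OF T]
  have "B = {}"
  proof (rule ccontr)
    assume "B \<noteq> {}"
    then obtain b where b: "b \<in> B" by blast
    \<comment> \<open>Lowering the bottom keeps the Lucas top and gains one dimension.\<close>
    then have "T - (B - {b}) = insert b (T - B)" using BT by blast
    then have "card (T - (B - {b})) = p + 1" using b fin BT by simp
    then show False
      using no_ext[of "B - {b}" T] BT T by blast
  qed
  moreover have "\<not> lucas_set n (insert i T)" if "i \<notin> T" for i
    using no_ext[of "{}" "insert i T"] that fin BT \<open>B = {}\<close> by auto
  ultimately show "\<exists>T. maximal_lucas_set n T \<and> card T = p \<and> H = lucas_cube n \<restriction> interval n {} T"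
    using BT T H_eq by (auto simp: maximal_lucas_set_def)
next
  assume "\<exists>T. maximal_lucas_set n T \<and> card T = p \<and> H = lucas_cube n \<restriction> interval n {} T"
  then obtain T where T: "maximal_lucas_set n T" "card T = p"
    and H: "H = lucas_cube n \<restriction> interval n {} T"
    by blast
  then have L: "lucas_set n T" by (simp add: maximal_lucas_set_def)
  have "\<not> subgraph H K" if K: "cube_in_lucas_cube n (p + 1) K" for K
  proof
    assume "subgraph H K"
    obtain B' T' where K': "B' \<subseteq> T'" "card (T' - B') = p + 1" "lucas_set n T'"
      "K = lucas_cube n \<restriction> interval n B' T'"
      using cube_in_lucas_cube_imp_interval[OF assms K] .
    have "B' = {}" "T \<subseteq> T'"
      using \<open>subgraph H K\<close> interval_subset_iff[of "{}" T n B' T'] lucas_set_subset[OF L]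
      unfolding H K'(4) subgraph_induce_iff[OF wf_lucas_cube] by auto
    \<comment> \<open>The sizes are \<open>p\<close> and \<open>p + 1\<close>. An extra element
      \<open>i\<close> of \<open>T'\<close> then makes \<open>insert i T\<close> a Lucas set,
      against maximality of \<open>T\<close>.\<close>
    moreover have "T \<noteq> T'"
      using K' T \<open>B' = {}\<close> by auto
    ultimately obtain i where "i \<in> T'" "i \<notin> T" "insert i T \<subseteq> T'"
      by blast
    then show False
      using T(1) lucas_set_mono[OF K'(3)] lucas_set_subset[OF K'(3)]
      by (auto simp: maximal_lucas_set_def)
  qed
  then show "maximal_cube_in_lucas_cube n p H"
    unfolding maximal_cube_in_lucas_cube_def H
    using interval_cube_in_lucas_cube[OF assms, of "{}" T p] T L by auto
qed

lemma num_maximal_cubes_eq: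
  assumes "0 < n"
  shows "num_maximal_cubes n p = card {T. maximal_lucas_set n T \<and> card T = p}"
proof -
  let ?I = "\<lambda>T. lucas_cube n \<restriction> interval n {} T"
  have "inj_on ?I {T. maximal_lucas_set n T \<and> card T = p}"
  proof (rule inj_onI)
    fix S T assume "S \<in> {T. maximal_lucas_set n T \<and> card T = p}"
      "T \<in> {T. maximal_lucas_set n T \<and> card T = p}" and eq: "?I S = ?I T"
    then have "S \<subseteq> {..<n}" "T \<subseteq> {..<n}"
      by (auto simp: maximal_lucas_set_def dest!: lucas_set_subset)
    moreover have "interval n {} S = interval n {} T"
      using arg_cong[OF eq, of verts] by simp
    ultimately show "S = T"
      using interval_subset_iff[of "{}" S n "{}" T] interval_subset_iff[of "{}" T n "{}" S] by auto
  qed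
  moreover have "{H. maximal_cube_in_lucas_cube n p H} = ?I ` {T. maximal_lucas_set n T \<and> card T = p}"
    using maximal_cube_in_lucas_cube_iff[OF assms] by auto
  ultimately show ?thesis
    by (simp add: num_maximal_cubes_def card_image)
qed


section \<open>Counting maximal Lucas strings\<close>

text \<open>Cyclically, no two adjacent ones and no three consecutive zeros. Letting
  \<open>i\<close> run over all naturals, with indices reduced modulo the length, makes invariance
  under rotation easy.\<close>

definition maximal_cyclic :: "bool list \<Rightarrow> bool" where
  "maximal_cyclic u \<longleftrightarrow> (\<forall>i.
     \<not> (u ! (i mod length u) \<and> u ! (Suc i mod length u)) \<and>
     (u ! (i mod length u) \<or> u ! (Suc i mod length u) \<or> u ! (Suc (Suc i) mod length u)))"

text \<open>A position can be added to a Lucas set when it is the middle of three zeros.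
  Nonemptiness excludes \<open>[False]\<close>: there \<open>{}\<close> is maximal, as
  \<open>{0}\<close> is not Lucas, yet the cyclic condition fails.\<close>

lemma maximal_lucas_set_iff_cyclic:
  assumes n: "0 < n" "length u = n" and ne: "ones u \<noteq> {}"
  shows "maximal_lucas_set n (ones u) \<longleftrightarrow> maximal_cyclic u"
proof -
  have mem: "u ! (i mod n) \<longleftrightarrow> i mod n \<in> ones u" for i
    using n by (simp add: ones_def)
  have cyc: "maximal_cyclic u \<longleftrightarrow> (\<forall>i. \<not> (i mod n \<in> ones u \<and> Suc i mod n \<in> ones u) \<and>
      (i mod n \<in> ones u \<or> Suc i mod n \<in> ones u \<or> Suc (Suc i) mod n \<in> ones u))"
    by (simp add: maximal_cyclic_def n(2) mem)
  show ?thesis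
    unfolding cyc
  proof (intro iffI allI conjI)
    fix i
    assume max: "maximal_lucas_set n (ones u)"
    then have L: "lucas_set n (ones u)"
      and M: "\<And>j. j < n \<Longrightarrow> j \<notin> ones u \<Longrightarrow> \<not> lucas_set n (insert j (ones u))"
      by (auto simp: maximal_lucas_set_def)
    have indep: "\<not> (k mod n \<in> ones u \<and> Suc k mod n \<in> ones u)" for k
    proof -
      have "\<not> (k mod n \<in> ones u \<and> Suc (k mod n) mod n \<in> ones u)"
        using L n(1) by (simp add: lucas_set_def)
      then show ?thesis by (simp add: mod_Suc_eq)
    qed
    then show "\<not> (i mod n \<in> ones u \<and> Suc i mod n \<in> ones u)" .
    \<comment> \<open>Needed below so that \<open>j\<close> is not its own successor.\<close>
    have "n \<noteq> 1"
      using ne indep[of 0] n by (auto simp: ones_def)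
    show "i mod n \<in> ones u \<or> Suc i mod n \<in> ones u \<or> Suc (Suc i) mod n \<in> ones u"
    proof (rule ccontr)
      assume *: "\<not> ?thesis"
      \<comment> \<open>The middle of the three zeros, to be added to the set.\<close>
      define j where "j = Suc i mod n"
      have "Suc j mod n \<notin> ones u"
        using * by (simp add: j_def mod_Suc_eq)
      moreover have "Suc j mod n \<noteq> j"
        using \<open>n \<noteq> 1\<close> n(1) by (auto simp: mod_Suc j_def)
      moreover have "k \<notin> ones u" if "k < n" "Suc k mod n = j" for k
      proof -
        have "k = i mod n"
          using that by (auto simp: j_def mod_Suc split: if_splits)
        then show ?thesis using * by simp
      qed
      ultimately have "lucas_set n (insert j (ones u))"
        using L n(1) by (auto simp: lucas_set_def j_def)
      then show False
        using M[of j] * n(1) by (simp add: j_def)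
    qed
  next
    assume R: "\<forall>i. \<not> (i mod n \<in> ones u \<and> Suc i mod n \<in> ones u) \<and>
      (i mod n \<in> ones u \<or> Suc i mod n \<in> ones u \<or> Suc (Suc i) mod n \<in> ones u)"
    have "lucas_set n (ones u)"
      unfolding lucas_set_def
    proof (intro conjI allI impI)
      fix i assume "i < n"
      then show "\<not> (i \<in> ones u \<and> Suc i mod n \<in> ones u)"
        using R[rule_format, of i] by simp
    qed (use n in \<open>simp add: ones_subset\<close>)
    moreover have "\<not> lucas_set n (insert j (ones u))" if j: "j < n" "j \<notin> ones u" for j
    proof
      assume L: "lucas_set n (insert j (ones u))"
      \<comment> \<open>The cyclic predecessor of \<open>j\<close>, written so that
        \<open>j = 0\<close> causes no truncated subtraction.\<close>
      define i where "i = j + (n - 1)"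
      have i: "Suc i mod n = j" "Suc (Suc i) mod n = Suc j mod n"
        using j n(1) by (auto simp: i_def mod_Suc)
      have "i mod n \<notin> ones u"
        using L j n(1) i(1) mod_Suc_eq[of i n] by (auto simp: lucas_set_def)
      moreover have "Suc j mod n \<notin> ones u"
        using L j by (auto simp: lucas_set_def)
      ultimately show False
        using R[rule_format, of i] j i by auto
    qed
    ultimately show "maximal_lucas_set n (ones u)"
      by (simp add: maximal_lucas_set_def)
  qed
qed

section \<open>Double counting under rotation\<close>

lemma length_filter_rotate: "length (filter P (rotate k u)) = length (filter P u)"
proof -
  have "length (filter P (rotate1 u)) = length (filter P u)" for u
    by (cases u) auto
  then show ?thesis
    by (induction k) auto
qed

lemma maximal_cyclic_rotate:
  assumes "maximal_cyclic u" "u \<noteq> []"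
  shows "maximal_cyclic (rotate k u)"
proof -
  have "rotate k u ! (i mod length u) = u ! ((k + i) mod length u)" for i
    using assms(2) by (simp add: nth_rotate mod_add_right_eq)
  then show ?thesis
    using assms(1) unfolding maximal_cyclic_def length_rotate by (metis add_Suc_right)
qed

text \<open>Rotation by \<open>i\<close> brings bit \<open>i\<close> to the front, and rotation by
  \<open>n - i\<close> undoes it.\<close>

lemma card_rotate:
  assumes M: "\<And>u k. u \<in> M \<Longrightarrow> rotate k u \<in> M" "\<And>u. u \<in> M \<Longrightarrow> length u = n" and i: "i < n"
  shows "card {u \<in> M. u ! i} = card {u \<in> M. u ! 0}"
proof (rule bij_betw_same_card, rule bij_betw_byWitness[where f' = "rotate (n - i)"])
  show "\<forall>u\<in>{u \<in> M. u ! i}. rotate (n - i) (rotate i u) = u"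
    "\<forall>u\<in>{u \<in> M. u ! 0}. rotate i (rotate (n - i) u) = u"
    using M(2) i by (simp_all add: rotate_rotate)
  show "rotate i ` {u \<in> M. u ! i} \<subseteq> {u \<in> M. u ! 0}"
    "rotate (n - i) ` {u \<in> M. u ! 0} \<subseteq> {u \<in> M. u ! i}"
    using M i by (auto simp: nth_rotate)
qed

text \<open>Count the pairs \<open>(u, i)\<close> with \<open>u ! i\<close>: each \<open>u\<close>
  has \<open>p\<close> of them, and by rotation each position has as many as position 0.\<close>

lemma double_count_ones:
  assumes M: "\<And>u k. u \<in> M \<Longrightarrow> rotate k u \<in> M" "\<And>u. u \<in> M \<Longrightarrow> length u = n"
    and weight: "\<And>u. u \<in> M \<Longrightarrow> length (filter id u) = p"
  shows "p * card M = n * card {u \<in> M. u ! 0}"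
proof -
  have fin: "finite M"
    using finite_lists_length_eq[of "UNIV :: bool set" n] M(2) by (auto intro: rev_finite_subset)
  have "card {i \<in> {..<n}. u ! i} = p" if "u \<in> M" for u
    using M(2)[OF that] weight[OF that] by (simp add: length_filter_conv_card)
  then have "p * card M = (\<Sum>u\<in>M. card {i \<in> {..<n}. u ! i})"
    by simp
  also have "\<dots> = (\<Sum>i<n. card {u \<in> M. u ! 0})"
  proof (rule sum_multicount_gen[OF fin])
    show "\<forall>i\<in>{..<n}. card {u \<in> M. u ! i} = card {u \<in> M. u ! 0}"
      using card_rotate[OF M] by blast
  qed simp
  finally show ?thesis by simp
qed

section \<open>Decomposition into the blocks 10 and 100\<close>

fun blocks :: "bool list \<Rightarrow> bool list" where
  "blocks [] = []"
| "blocks (b # c) = (if b then [True, False, False] else [True, False]) @ blocks c"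

lemma length_blocks: "length (blocks c) = 2 * length c + length (filter id c)"
  by (induction c) auto

lemma weight_blocks: "length (filter id (blocks c)) = length c"
  by (induction c) auto

text \<open>What follows a block is empty or starts with a one. This tells 10 from 100, so decoding
  is unique, and it keeps junctions between blocks sparse.\<close>

lemma hd_blocks: "blocks c = [] \<or> (\<exists>v. blocks c = True # v)"
  by (cases c) auto

lemma inj_blocks: "blocks c = blocks c' \<Longrightarrow> c = c'"
proof (induction c arbitrary: c')
  case Nil
  then show ?case by (cases c') (auto split: if_splits)
next
  case (Cons b c)
  then show ?case
    using hd_blocks[of c] hd_blocks[of "tl c'"] by (cases c') (auto split: if_splits)
qed

text \<open>The linear form of \<open>maximal_cyclic\<close> for strings that begin with a one.\<close>

definition sparse :: "bool list \<Rightarrow> bool" where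
  "sparse u \<longleftrightarrow>
     (\<forall>i. Suc i < length u \<longrightarrow> \<not> (u ! i \<and> u ! Suc i)) \<and>
     (\<forall>i. Suc (Suc i) < length u \<longrightarrow> u ! i \<or> u ! Suc i \<or> u ! Suc (Suc i)) \<and>
     (u \<noteq> [] \<longrightarrow> hd u \<and> \<not> last u)"

text \<open>An exhaustive case distinction on the first bits: each rule decides the string or strips
  its first block.\<close>

lemma sparse_simps:
  "sparse []"
  "\<not> sparse (False # u)"
  "\<not> sparse [True]"
  "\<not> sparse (True # True # u)"
  "sparse [True, False]"
  "sparse (True # False # True # u) \<longleftrightarrow> sparse (True # u)"
  "sparse [True, False, False]"
  "\<not> sparse (True # False # False # False # u)"
  "sparse (True # False # False # True # u) \<longleftrightarrow> sparse (True # u)"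
  by (simp_all add: sparse_def All_less_Suc2) (cases u; simp add: All_less_Suc2; blast)+

lemma sparse_blocks: "sparse (blocks c)"
proof (induction c)
  case (Cons b c)
  then show ?case
    using hd_blocks[of c] by (auto simp: sparse_simps)
qed (simp add: sparse_simps)

lemma sparse_imp_blocks: "sparse u \<Longrightarrow> \<exists>c. u = blocks c"
proof (induction u rule: length_induct)
  case (1 u)
  have IH: "\<exists>c. v = blocks c" if "sparse v" "length v < length u" for v
    using 1 that by blast
  consider "u = []" | "u = [True, False]" | "u = [True, False, False]"
    | v where "u = True # False # True # v" "sparse (True # v)"
    | v where "u = True # False # False # True # v" "sparse (True # v)"
    using 1(2) by (metis (full_types) list.exhaust sparse_simps)
  then show ?case
  proof cases
    case 1
    then show ?thesis by (auto intro: exI[of _ "[]"])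
  next
    case 2
    then show ?thesis by (auto intro: exI[of _ "[False]"])
  next
    case 3
    then show ?thesis by (auto intro: exI[of _ "[True]"])
  next
    case (4 v)
    then obtain c where "True # v = blocks c" using IH[of "True # v"] by auto
    with 4 have "u = blocks (False # c)" by simp
    then show ?thesis ..
  next
    case (5 v)
    then obtain c where "True # v = blocks c" using IH[of "True # v"] by auto
    with 5 have "u = blocks (True # c)" by simp
    then show ?thesis ..
  qed
qed

text \<open>With a one in front, every wrapping triple contains position 0 and is satisfied; the
  only wrapping pair demands that the last bit be zero.\<close>

lemma sparse_iff_cyclic:
  assumes "u \<noteq> []" "u ! 0"
  shows "maximal_cyclic u \<longleftrightarrow> sparse u"
proof
  assume R: "maximal_cyclic u"
  let ?n = "length u"
  have "\<not> last u"
    using R[unfolded maximal_cyclic_def, rule_format, of "?n - 1"] assms by (simp add: last_conv_nth)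
  moreover have "\<not> (u ! i \<and> u ! Suc i)" if "Suc i < ?n" for i
    using R[unfolded maximal_cyclic_def, rule_format, of i] that by simp
  moreover have "u ! i \<or> u ! Suc i \<or> u ! Suc (Suc i)" if "Suc (Suc i) < ?n" for i
    using R[unfolded maximal_cyclic_def, rule_format, of i] that by simp
  ultimately show "sparse u"
    using assms by (simp add: sparse_def hd_conv_nth)
next
  assume S: "sparse u"
  let ?n = "length u"
  show "maximal_cyclic u"
    unfolding maximal_cyclic_def
  proof
    fix k
    define i where "i = k mod ?n"
    have "i < ?n" using assms by (simp add: i_def)
    have k: "Suc k mod ?n = Suc i mod ?n" "Suc (Suc k) mod ?n = Suc (Suc i) mod ?n"
      by (simp_all add: i_def mod_Suc_eq mod_Suc_Suc_eq)
    \<comment> \<open>The cases are where the window of three wraps: after its first bit, after its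
      second, or not at all.\<close>
    consider "Suc i = ?n" | "Suc (Suc i) = ?n" | "Suc (Suc i) < ?n"
      using \<open>i < ?n\<close> by linarith
    then show "\<not> (u ! (k mod ?n) \<and> u ! (Suc k mod ?n)) \<and>
      (u ! (k mod ?n) \<or> u ! (Suc k mod ?n) \<or> u ! (Suc (Suc k) mod ?n))"
      unfolding k i_def[symmetric]
    proof cases
      case 1
      then have "i = ?n - 1" by simp
      then have "\<not> u ! i"
        using S assms by (simp add: sparse_def last_conv_nth)
      with 1 assms show "\<not> (u ! i \<and> u ! (Suc i mod ?n)) \<and>
        (u ! i \<or> u ! (Suc i mod ?n) \<or> u ! (Suc (Suc i) mod ?n))" by simp
    next
      case 2
      then show "\<not> (u ! i \<and> u ! (Suc i mod ?n)) \<and>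
        (u ! i \<or> u ! (Suc i mod ?n) \<or> u ! (Suc (Suc i) mod ?n))"
        using S assms by (simp add: sparse_def)
    next
      case 3
      then show "\<not> (u ! i \<and> u ! (Suc i mod ?n)) \<and>
        (u ! i \<or> u ! (Suc i mod ?n) \<or> u ! (Suc (Suc i) mod ?n))"
        using S by (simp add: sparse_def)
    qed
  qed
qed

lemma card_maximal_cyclic_first:
  assumes "0 < p"
  shows "card {u. length u = n \<and> maximal_cyclic u \<and> length (filter id u) = p \<and> u ! 0} =
    binom p (int n - 2 * int p)"
proof -
  have "{u. length u = n \<and> maximal_cyclic u \<and> length (filter id u) = p \<and> u ! 0} =
    blocks ` {c. length c = p \<and> 2 * p + length (filter id c) = n}" (is "?L = blocks ` ?C")
  proof (intro set_eqI iffI)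
    fix u assume u: "u \<in> ?L"
    then have "u \<noteq> []" using assms by auto
    with u have "sparse u" by (simp flip: sparse_iff_cyclic)
    then obtain c where "u = blocks c" using sparse_imp_blocks by blast
    with u show "u \<in> blocks ` ?C"
      by (auto simp: length_blocks weight_blocks)
  next
    fix u assume "u \<in> blocks ` ?C"
    then obtain c where c: "u = blocks c" "c \<in> ?C" by blast
    then have "u \<noteq> []" "u ! 0"
      using assms hd_blocks[of c] by (cases c; auto)+
    then show "u \<in> ?L"
      using c sparse_blocks[of c] by (simp add: sparse_iff_cyclic length_blocks weight_blocks)
  qed
  then have "card ?L = card ?C"
    by (simp add: card_image inj_on_def inj_blocks)
  also have "\<dots> = binom p (int n - 2 * int p)"
  proof (cases "2 * p \<le> n")
    case True
    then have "?C = {c. length c = p \<and> length (filter id c) = n - 2 * p}"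
      by auto
    moreover have "nat (int n - 2 * int p) = n - 2 * p"
      by simp
    ultimately show ?thesis
      using True by (simp add: card_strings_weight binom_def)
  next
    \<comment> \<open>No code has negative weight, and \<open>binom\<close> is 0 at a negative
      argument.\<close>
    case False
    then have "?C = {}" by auto
    then show ?thesis
      using False by (simp add: binom_def)
  qed
  finally show ?thesis .
qed

lemma num_maximal_cubes_eq_card_cyclic:
  assumes "0 < n" "0 < p"
  shows "num_maximal_cubes n p =
    card {u. length u = n \<and> maximal_cyclic u \<and> length (filter id u) = p}"
proof -
  have "bij_betw ones {u. length u = n \<and> maximal_cyclic u \<and> length (filter id u) = p}
    {T. maximal_lucas_set n T \<and> card T = p}"
  proof (rule bij_betw_byWitness[where f' = "string_of n"])
    \<comment> \<open>Here \<open>0 < p\<close> supplies the nonempty set of ones.\<close>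
    have iff: "maximal_cyclic u \<longleftrightarrow> maximal_lucas_set n (ones u)"
      if "length u = n" "card (ones u) = p" for u
      using maximal_lucas_set_iff_cyclic[of n u] that assms by fastforce
    have sub: "T \<subseteq> {..<n}" if "maximal_lucas_set n T" for T
      using that lucas_set_subset by (auto simp: maximal_lucas_set_def)
    show "\<forall>T\<in>{T. maximal_lucas_set n T \<and> card T = p}. ones (string_of n T) = T"
      using sub by (simp add: ones_string_of)
    then show "string_of n ` {T. maximal_lucas_set n T \<and> card T = p} \<subseteq>
      {u. length u = n \<and> maximal_cyclic u \<and> length (filter id u) = p}"
      using iff by (auto simp: card_ones[symmetric])
    show "ones ` {u. length u = n \<and> maximal_cyclic u \<and> length (filter id u) = p} \<subseteq>
      {T. maximal_lucas_set n T \<and> card T = p}"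
      using iff by (auto simp: card_ones[symmetric])
  qed (simp add: string_of_ones)
  then show ?thesis
    using num_maximal_cubes_eq[OF assms(1)] by (simp add: bij_betw_same_card)
qed

theorem theorem2:
  fixes n p :: nat
  assumes "1 \<le> p" and "p \<le> n"
  shows "real (num_maximal_cubes n p) =
    real n / real p * real (binom p (int n - 2 * int p))"
proof -
  let ?M = "{u. length u = n \<and> maximal_cyclic u \<and> length (filter id u) = p}"
  have pos: "0 < p" "0 < n" using assms by auto
  have "p * card ?M = n * card {u \<in> ?M. u ! 0}"
    using pos by (intro double_count_ones) (auto simp: length_filter_rotate intro!: maximal_cyclic_rotate)
  also have "{u \<in> ?M. u ! 0} =
      {u. length u = n \<and> maximal_cyclic u \<and> length (filter id u) = p \<and> u ! 0}"
    by auto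
  finally have "p * num_maximal_cubes n p = n * binom p (int n - 2 * int p)"
    using pos by (simp only: num_maximal_cubes_eq_card_cyclic card_maximal_cyclic_first)
  \<comment> \<open>The identity was multiplicative in the naturals; the division by
    \<open>p\<close> takes place in the reals.\<close>
  then have "real p * real (num_maximal_cubes n p) = real n * real (binom p (int n - 2 * int p))"
    by (metis of_nat_mult)
  then show ?thesis
    using pos by (simp add: field_simps)
qed

end
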